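(* Let $A_1$ and $A_2$ be connected simple graphs of order $n>2$, with the same label on the edges of both graphs, and let $B_1,B_2$ be their binding graphs, with binding edges carrying that same label. Then: (1) $A_1\cong A_2$ if and only if $B_1\cong B_2$; (2) $\mathrm{Aut}(A_1)\cong\mathrm{Aut}(B_1)$; (3) no basic vertex of $B_1$ lies in the same $\mathrm{Aut}(B_1)$-orbit as a binding vertex; (4) the $\mathrm{Aut}(B_1)$-orbits consisting of basic vertices are exactly the $\mathrm{Aut}(A_1)$-orbits.
   Context: Labels are indeterminates $x_0,x_1,\dots$. A graph of order $N$ is a symmetric $N\times N$ matrix $(g_{ij})$ with entries among these labels; $j$ is a neighbour of $i$ iff $i\ne j$ and $g_{ij}\ne x_0$. A simple graph has all diagonal entries $x_0$ and at most two distinct entries (so all edges carry one label). Two graphs $A,B$ of order $N$ are isomorphic ($A\cong B$) if there is a permutation $\sigma$ of $[N]$ with $a_{i^\sigma j^\sigma}=b_{ij}$ for all $i,j$; automorphisms are isomorphisms of a graph to itself. The binding graph $B$ of a simple graph $A$ on $[n]$ is the simple graph on $[n_1]$, $n_1=n(n+1)/2$, whose subgraph induced on $[n]$ is $A$ and in which, for each pair of distinct $u,v\in[n]$, there is a unique vertex $p=u\dot\wedge v\in\{n+1,\dots,n_1\}$ adjacent exactly to $u$ and $v$ (the edges $(u,p),(v,p)$ are binding edges). Vertices in $[n]$ are basic, the others binding vertices. *)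

theory Defs
  imports
    "Jordan_Normal_Form.Matrix"
    "HOL-Combinatorics.Permutations"
    "HOL-Algebra.Group_Action"
begin

text \<open>The constructor \<open>X i\<close> stands for the indeterminate $x_i$. Labels are only ever compared for
  equality, so no polynomial structure on them is needed.\<close>

datatype label = X nat

text \<open>Vertices are indexed from 0, as are matrix entries: the vertex set $\{1,\dots,N\}$ of a graph
  of order \<open>N\<close> is rendered as \<open>{..<N}\<close>.\<close>

definition graph :: "nat \<Rightarrow> label mat \<Rightarrow> bool" where
  "graph N A \<longleftrightarrow> A \<in> carrier_mat N N \<and> transpose_mat A = A"

definition neighbour :: "label mat \<Rightarrow> nat \<Rightarrow> nat \<Rightarrow> bool" where
  "neighbour A i j \<longleftrightarrow> i < dim_row A \<and> j < dim_row A \<and> i \<noteq> j \<and> A $$ (i, j) \<noteq> X 0"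

definition simple_graph :: "nat \<Rightarrow> label mat \<Rightarrow> bool" where
  "simple_graph N A \<longleftrightarrow> graph N A \<and> (\<forall>i<N. A $$ (i, i) = X 0) \<and> card (elements_mat A) \<le> 2"

definition connected_graph :: "label mat \<Rightarrow> bool" where
  "connected_graph A \<longleftrightarrow> (\<forall>u<dim_row A. \<forall>v<dim_row A. (neighbour A)\<^sup>*\<^sup>* u v)"

definition edges_labelled :: "label \<Rightarrow> label mat \<Rightarrow> bool" where
  "edges_labelled l A \<longleftrightarrow> (\<forall>i j. neighbour A i j \<longrightarrow> A $$ (i, j) = l)"

definition graph_isos :: "nat \<Rightarrow> label mat \<Rightarrow> label mat \<Rightarrow> (nat \<Rightarrow> nat) set" where
  "graph_isos N A B =
     {\<sigma>. \<sigma> permutes {..<N} \<and> (\<forall>i<N. \<forall>j<N. A $$ (\<sigma> i, \<sigma> j) = B $$ (i, j))}"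

definition graph_isomorphic :: "nat \<Rightarrow> label mat \<Rightarrow> label mat \<Rightarrow> bool" where
  "graph_isomorphic N A B \<longleftrightarrow> graph_isos N A B \<noteq> {}"

text \<open>Permutations are multiplied by functional composition. With the right-action notation
  $i^\sigma$ the product would be the opposite one, but a map is an isomorphism of two groups iff it
  is one of their opposite groups.\<close>

definition aut_group :: "nat \<Rightarrow> label mat \<Rightarrow> (nat \<Rightarrow> nat) monoid" where
  "aut_group N A = \<lparr>carrier = graph_isos N A A, mult = (\<circ>), one = id\<rparr>"

lemma group_aut_group: "group (aut_group N A)"
proof (rule groupI)
  fix \<sigma> assume s: "\<sigma> \<in> carrier (aut_group N A)"
  then have p: "\<sigma> permutes {..<N}" by (simp add: aut_group_def graph_isos_def)
  have "inv_into UNIV \<sigma> \<in> graph_isos N A A"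
    unfolding graph_isos_def
  proof (clarsimp simp: permutes_inv[OF p])
    fix i j assume ij: "i < N" "j < N"
    have "inv_into UNIV \<sigma> i < N" "inv_into UNIV \<sigma> j < N"
      using permutes_in_image[OF permutes_inv[OF p]] ij by auto
    then have "A $$ (\<sigma> (inv_into UNIV \<sigma> i), \<sigma> (inv_into UNIV \<sigma> j))
        = A $$ (inv_into UNIV \<sigma> i, inv_into UNIV \<sigma> j)"
      using s by (simp add: aut_group_def graph_isos_def)
    then show "A $$ (inv_into UNIV \<sigma> i, inv_into UNIV \<sigma> j) = A $$ (i, j)"
      by (simp add: permutes_inverses[OF p])
  qed
  then show "\<exists>\<tau>\<in>carrier (aut_group N A). \<tau> \<otimes>\<^bsub>aut_group N A\<^esub> \<sigma> = \<one>\<^bsub>aut_group N A\<^esub>"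
    by (auto simp: aut_group_def permutes_inv_o[OF p] intro!: bexI[of _ "inv_into UNIV \<sigma>"])
next
  fix \<sigma> \<tau> assume "\<sigma> \<in> carrier (aut_group N A)" "\<tau> \<in> carrier (aut_group N A)"
  moreover from this have "\<tau> i < N" if "i < N" for i
    using permutes_in_image[of \<tau> "{..<N}" i] that by (simp add: aut_group_def graph_isos_def)
  ultimately show "\<sigma> \<otimes>\<^bsub>aut_group N A\<^esub> \<tau> \<in> carrier (aut_group N A)"
    by (simp add: aut_group_def graph_isos_def permutes_compose)
qed (auto simp: aut_group_def graph_isos_def permutes_id)

definition aut_orbits :: "nat \<Rightarrow> label mat \<Rightarrow> nat set set" where
  "aut_orbits N A = orbits (aut_group N A) {..<N} (\<lambda>\<sigma>. \<sigma>)"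

definition binding_order :: "nat \<Rightarrow> nat" where
  "binding_order n = n * (n + 1) div 2"

definition basic_vertices :: "nat \<Rightarrow> nat set" where
  "basic_vertices n = {..<n}"

definition binding_vertices :: "nat \<Rightarrow> nat set" where
  "binding_vertices n = {n..<binding_order n}"

text \<open>The numbering of the binding vertices is left open, so \<open>B\<close> ranges over all binding graphs of
  \<open>A\<close>. There are as many binding vertices as unordered pairs of basic ones, and distinct pairs have
  distinct binding vertices; hence every binding vertex belongs to a pair.\<close>

definition binding_graph :: "nat \<Rightarrow> label mat \<Rightarrow> label mat \<Rightarrow> bool" where
  "binding_graph n A B \<longleftrightarrow>
     simple_graph (binding_order n) B \<and>
     (\<forall>i\<in>basic_vertices n. \<forall>j\<in>basic_vertices n. B $$ (i, j) = A $$ (i, j)) \<and>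
     (\<forall>u\<in>basic_vertices n. \<forall>v\<in>basic_vertices n. u \<noteq> v \<longrightarrow>
        (\<exists>!p. p \<in> binding_vertices n \<and> {w. neighbour B p w} = {u, v}))"

end

theory Submission
  imports Defs
begin

text \<open>In a binding graph a binding vertex has degree 2, while a basic vertex has degree
  $(n - 1) + d$, where $d \geq 1$ is its degree in the connected graph \<open>A\<close>, hence at least 3.
  So isomorphisms of binding graphs preserve basic vertices and restrict to isomorphisms of the
  underlying graphs. Conversely an isomorphism of the underlying graphs acts on the unordered pairs
  of basic vertices, that is, on the binding vertices, and this is its only extension. The
  restriction map is thus a bijection, and a group isomorphism when both graphs coincide.\<close>

section \<open>Adjacency and isomorphisms of simple graphs\<close>

definition neighbours :: "label mat \<Rightarrow> nat \<Rightarrow> nat set" where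
  "neighbours A i = {j. neighbour A i j}"

definition pairs :: "nat \<Rightarrow> nat set set" where
  "pairs n = {P. P \<subseteq> {..<n} \<and> card P = 2}"

text \<open>Being the identity from \<open>n\<close> on, as \<open>permutes\<close> demands, makes
  the restriction literally an element of \<open>graph_isos n\<close>.\<close>

definition restrict_perm :: "nat \<Rightarrow> (nat \<Rightarrow> nat) \<Rightarrow> nat \<Rightarrow> nat" where
  "restrict_perm n \<sigma> i = (if i < n then \<sigma> i else i)"

lemma in_neighbours_iff: "j \<in> neighbours A i \<longleftrightarrow> neighbour A i j"
  by (simp add: neighbours_def)

lemma simple_graph_dim: "simple_graph N A \<Longrightarrow> dim_row A = N \<and> dim_col A = N"
  by (auto simp: simple_graph_def graph_def)

lemma neighbour_less:
  assumes "simple_graph N A" and "neighbour A i j"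
  shows "i < N" and "j < N"
  using assms by (auto simp: neighbour_def dest: simple_graph_dim)

lemma neighbours_subset: "simple_graph N A \<Longrightarrow> neighbours A i \<subseteq> {..<N}"
  by (auto simp: neighbours_def dest: neighbour_less)

lemma finite_neighbours: "simple_graph N A \<Longrightarrow> finite (neighbours A i)"
  by (rule finite_subset[OF neighbours_subset finite_lessThan])

lemma neighbour_sym:
  assumes "simple_graph N A"
  shows "neighbour A i j \<longleftrightarrow> neighbour A j i"
proof -
  have "A $$ (j, i) = A $$ (i, j)" if "i < N" "j < N"
  proof -
    have "transpose_mat A $$ (i, j) = A $$ (j, i)"
      using assms that simple_graph_dim by (intro index_transpose_mat) auto
    then show ?thesis using assms by (simp add: simple_graph_def graph_def)
  qed
  then show ?thesis
    using simple_graph_dim[OF assms] by (auto simp: neighbour_def)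
qed

lemma graph_entry:
  assumes "simple_graph N A" and "edges_labelled l A" and "i < N" and "j < N"
  shows "A $$ (i, j) = (if neighbour A i j then l else X 0)"
  using assms simple_graph_dim[OF assms(1)]
  by (auto simp: edges_labelled_def neighbour_def simple_graph_def)

text \<open>With a single edge label \<open>l\<close> common to both graphs, an entry is determined
  by adjacency, so comparing labels reduces to comparing edges.\<close>

lemma graph_isos_iff:
  assumes A: "simple_graph N A" "edges_labelled l A"
    and B: "simple_graph N B" "edges_labelled l B"
  shows "\<sigma> \<in> graph_isos N A B \<longleftrightarrow>
    \<sigma> permutes {..<N} \<and> (\<forall>i<N. \<forall>j<N. neighbour A (\<sigma> i) (\<sigma> j) \<longleftrightarrow> neighbour B i j)"
proof (cases "\<sigma> permutes {..<N}")
  case p: True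
  have "A $$ (\<sigma> i, \<sigma> j) = B $$ (i, j) \<longleftrightarrow> (neighbour A (\<sigma> i) (\<sigma> j) \<longleftrightarrow> neighbour B i j)"
    if "i < N" "j < N" for i j
  proof -
    have less: "\<sigma> i < N" "\<sigma> j < N" using permutes_in_image[OF p] that by auto
    \<comment> \<open>Injectivity keeps off-diagonal positions off the diagonal; on the diagonal
      both entries are \<open>X 0\<close> and neither side has an adjacency.\<close>
    have "\<sigma> i = \<sigma> j \<longleftrightarrow> i = j" using permutes_inj[OF p] by (auto dest: injD)
    moreover have "A $$ (\<sigma> i, \<sigma> i) = X 0" "B $$ (i, i) = X 0"
      using A B that less by (auto simp: simple_graph_def)
    ultimately show ?thesis
      using graph_entry[OF A less] graph_entry[OF B that] less that
        simple_graph_dim[OF A(1)] simple_graph_dim[OF B(1)]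
      by (cases "i = j") (auto simp: neighbour_def)
  qed
  then show ?thesis using p by (auto simp: graph_isos_def)
qed (simp add: graph_isos_def)

lemma graph_isos_permutes: "\<sigma> \<in> graph_isos N A B \<Longrightarrow> \<sigma> permutes {..<N}"
  by (simp add: graph_isos_def)

text \<open>The direction follows \<open>graph_isos\<close>: an element of
  \<open>graph_isos N A B\<close> sends vertices of \<open>B\<close> to vertices of
  \<open>A\<close>. Surjectivity on \<open>{..<N}\<close> yields the inclusion from left to
  right.\<close>

lemma neighbours_graph_iso:
  assumes A: "simple_graph N A" "edges_labelled l A"
    and B: "simple_graph N B" "edges_labelled l B"
    and s: "\<sigma> \<in> graph_isos N A B" and i: "i < N"
  shows "neighbours A (\<sigma> i) = \<sigma> ` neighbours B i"
proof -
  have p: "\<sigma> permutes {..<N}" using s by (rule graph_isos_permutes)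
  have nb: "neighbour A (\<sigma> i) (\<sigma> j) \<longleftrightarrow> neighbour B i j" if "j < N" for j
    using s i that graph_isos_iff[OF A B] by blast
  show ?thesis
  proof (intro equalityI subsetI)
    fix k assume k: "k \<in> neighbours A (\<sigma> i)"
    then have "k < N" using A by (auto simp: in_neighbours_iff dest: neighbour_less)
    then have "k \<in> \<sigma> ` {..<N}" using permutes_image[OF p] by auto
    then show "k \<in> \<sigma> ` neighbours B i" using k nb by (auto simp: in_neighbours_iff)
  next
    fix k assume "k \<in> \<sigma> ` neighbours B i"
    then show "k \<in> neighbours A (\<sigma> i)"
      using nb neighbour_less(2)[OF B(1)] by (auto simp: in_neighbours_iff)
  qed
qed

lemma mem_orbit_self: "x \<in> orbit (aut_group M C) (\<lambda>\<sigma>. \<sigma>) x"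
proof -
  have "id \<in> graph_isos M C C" by (simp add: graph_isos_def permutes_id)
  then show ?thesis by (auto simp: orbit_def aut_group_def intro!: exI[of _ id])
qed

text \<open>The first step of a path from \<open>u\<close> to any other vertex, here 0 or 1, leads
  to a neighbour.\<close>

lemma connected_graph_has_neighbour:
  assumes "connected_graph A" and "dim_row A > 1" and "u < dim_row A"
  obtains w where "neighbour A u w"
proof -
  obtain v where v: "v < dim_row A" "v \<noteq> u"
    using assms(2) that[of 0] that[of 1] by (cases "u = 0") auto
  then have "(neighbour A)\<^sup>*\<^sup>* u v" using assms by (auto simp: connected_graph_def)
  then show ?thesis using v that by (auto elim: converse_rtranclpE)
qed

section \<open>Counting unordered pairs of basic vertices\<close>

lemma binding_order_conv: "binding_order n = n + (n choose 2)"
proof -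
  have "n * (n + 1) = n * 2 + n * (n - 1)" by (cases n) auto
  then show ?thesis by (simp add: binding_order_def choose_two)
qed

lemma card_pairs: "card (pairs n) = n choose 2"
  using n_subsets[of "{..<n}" 2] by (simp add: pairs_def)

text \<open>Taking images under the inverse permutation is the inverse map, and injectivity
  preserves the size 2.\<close>

lemma bij_betw_pairs_image:
  assumes "\<tau> permutes {..<n}"
  shows "bij_betw ((`) \<tau>) (pairs n) (pairs n)"
proof (rule bij_betw_byWitness[where f' = "(`) (inv_into UNIV \<tau>)"])
  have "\<rho> ` P \<in> pairs n" if "\<rho> permutes {..<n}" "P \<in> pairs n" for \<rho> P
    using that permutes_image[OF that(1)] card_image[OF permutes_inj_on[OF that(1)], of P]
    by (auto simp: pairs_def)
  then show "(`) \<tau> ` pairs n \<subseteq> pairs n" "(`) (inv_into UNIV \<tau>) ` pairs n \<subseteq> pairs n"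
    using assms permutes_inv[OF assms] by blast+
qed (simp_all add: image_image permutes_inverses[OF assms])

section \<open>Degrees in a binding graph\<close>

locale bound_graph =
  fixes n :: nat and l :: label and A B :: "label mat"
  assumes n_gt: "n > 2"
    and simple_A: "simple_graph n A" and connected: "connected_graph A"
    and label_A: "edges_labelled l A"
    and binding: "binding_graph n A B" and label_B: "edges_labelled l B"
begin

abbreviation "N \<equiv> binding_order n"

lemma simple_B: "simple_graph N B"
  using binding by (simp add: binding_graph_def)

lemma n_le: "n \<le> N"
  by (simp add: binding_order_conv)

lemma neighbour_basic:
  assumes "i < n" "j < n"
  shows "neighbour B i j \<longleftrightarrow> neighbour A i j"
proof -
  have "B $$ (i, j) = A $$ (i, j)"
    using assms binding by (simp add: binding_graph_def basic_vertices_def)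
  then show ?thesis
    using assms n_le simple_graph_dim[OF simple_A] simple_graph_dim[OF simple_B]
    by (simp add: neighbour_def)
qed

text \<open>Every pair has a binding vertex and there are as many pairs as binding vertices, so no
  binding vertex is left over.\<close>

lemma bij_betw_neighbours: "bij_betw (neighbours B) {n..<N} (pairs n)"
proof -
  have sub: "pairs n \<subseteq> neighbours B ` {n..<N}"
  proof
    fix P assume "P \<in> pairs n"
    then obtain u v where uv: "P = {u, v}" "u \<noteq> v" "u < n" "v < n"
      by (auto simp: pairs_def card_2_iff)
    then have "\<exists>!p. p \<in> {n..<N} \<and> neighbours B p = P"
      using binding by (simp add: binding_graph_def basic_vertices_def binding_vertices_def
        neighbours_def)
    then show "P \<in> neighbours B ` {n..<N}" by blast
  qed
  have c: "card (pairs n) = card {n..<N}" by (simp add: card_pairs binding_order_conv)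
  have "card (neighbours B ` {n..<N}) \<le> card (pairs n)"
    unfolding c by (rule card_image_le) simp
  with sub have eq: "pairs n = neighbours B ` {n..<N}"
    by (intro card_seteq) auto
  then have "inj_on (neighbours B) {n..<N}"
    using c by (intro eq_card_imp_inj_on) auto
  then show ?thesis using eq by (simp add: bij_betw_def)
qed

lemma neighbours_binding_pair: "p \<in> {n..<N} \<Longrightarrow> neighbours B p \<in> pairs n"
  using bij_betwE[OF bij_betw_neighbours] by blast

text \<open>All neighbours of a binding vertex lie in its pair and are therefore basic.\<close>

lemma not_neighbour_binding:
  assumes "i \<in> {n..<N}" "j \<in> {n..<N}"
  shows "\<not> neighbour B i j"
proof
  assume "neighbour B i j"
  then have "j \<in> neighbours B i" by (simp add: in_neighbours_iff)
  moreover have "neighbours B i \<subseteq> {..<n}"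
    using neighbours_binding_pair[OF assms(1)] by (simp add: pairs_def)
  ultimately show False using assms(2) by auto
qed

text \<open>A basic vertex has a neighbour \<open>w\<close> in \<open>A\<close>, and for a third vertex \<open>x\<close> the binding vertices
  of \<open>{u, w}\<close> and \<open>{u, x}\<close> are two further ones.\<close>

lemma card_neighbours_basic:
  assumes u: "u < n"
  shows "card (neighbours B u) > 2"
proof -
  obtain w where w: "neighbour A u w"
    using connected_graph_has_neighbour[OF connected] simple_graph_dim[OF simple_A] u n_gt
    by auto
  then have wn: "w < n" "w \<noteq> u" using neighbour_less[OF simple_A] by (auto simp: neighbour_def)
  have "card ({..<n} - {u, w}) > 0"
    using u wn n_gt by (subst card_Diff_subset) auto
  then obtain x where x: "x < n" "x \<noteq> u" "x \<noteq> w" by (auto simp: card_gt_0_iff)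
  have bound: "\<exists>p\<in>{n..<N}. neighbours B p = {u, v}" if "v < n" "v \<noteq> u" for v
  proof -
    have "{u, v} \<in> pairs n" using u that by (auto simp: pairs_def)
    then have "{u, v} \<in> neighbours B ` {n..<N}"
      using bij_betw_neighbours by (simp add: bij_betw_def)
    then show ?thesis by (metis imageE)
  qed
  obtain p where p: "p \<in> {n..<N}" "neighbours B p = {u, w}" using bound[OF wn] by (rule bexE)
  obtain q where q: "q \<in> {n..<N}" "neighbours B q = {u, x}" using bound[OF x(1,2)] by (rule bexE)
  have "{u, w} \<noteq> {u, x}" using x by auto
  then have "p \<noteq> q" using p q by auto
  then have "card {w, p, q} = 3" using p(1) q(1) wn(1) by auto
  \<comment> \<open>The pairs describe adjacency as seen from \<open>p\<close> and \<open>q\<close>;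
    symmetry of \<open>B\<close> turns this into adjacency as seen from \<open>u\<close>.\<close>
  moreover have "u \<in> neighbours B p" "u \<in> neighbours B q"
    by (simp_all add: p q)
  then have "neighbour B u p" "neighbour B u q"
    by (simp_all add: in_neighbours_iff neighbour_sym[OF simple_B, of u])
  then have "{w, p, q} \<subseteq> neighbours B u"
    using w neighbour_basic[OF u wn(1)] by (simp add: in_neighbours_iff)
  then have "card {w, p, q} \<le> card (neighbours B u)"
    by (rule card_mono[OF finite_neighbours[OF simple_B]])
  ultimately show ?thesis by linarith
qed

text \<open>Binding vertices have degree exactly 2. This describes being basic by a quantity that
  isomorphisms preserve.\<close>

lemma basic_iff_card_neighbours:
  assumes "i < N"
  shows "i < n \<longleftrightarrow> card (neighbours B i) > 2"
proof (cases "i < n")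
  case False
  then have "card (neighbours B i) = 2"
    using neighbours_binding_pair[of i] assms by (simp add: pairs_def)
  then show ?thesis using False by simp
qed (simp add: card_neighbours_basic)

end

section \<open>Restricting and extending isomorphisms of binding graphs\<close>

locale two_bound_graphs =
  G1: bound_graph n l A1 B1 + G2: bound_graph n l A2 B2 for n l A1 B1 A2 B2
begin

lemmas isos_A_iff =
  graph_isos_iff[OF G1.simple_A G1.label_A G2.simple_A G2.label_A]

lemmas isos_B_iff =
  graph_isos_iff[OF G1.simple_B G1.label_B G2.simple_B G2.label_B]

lemmas neighbours_iso_B =
  neighbours_graph_iso[OF G1.simple_B G1.label_B G2.simple_B G2.label_B]

text \<open>An isomorphism preserves degrees, and the degree tells basic vertices from binding
  ones.\<close>

lemma iso_preserves_basic:
  assumes s: "\<sigma> \<in> graph_isos (binding_order n) B1 B2" and i: "i < binding_order n"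
  shows "\<sigma> i < n \<longleftrightarrow> i < n"
proof -
  have p: "\<sigma> permutes {..<binding_order n}" using s by (rule graph_isos_permutes)
  have "card (neighbours B1 (\<sigma> i)) = card (neighbours B2 i)"
    unfolding neighbours_iso_B[OF s i] by (rule card_image[OF permutes_inj_on[OF p]])
  moreover have "\<sigma> i < binding_order n" using permutes_in_image[OF p] i by auto
  ultimately show ?thesis
    using G1.basic_iff_card_neighbours[of "\<sigma> i"] G2.basic_iff_card_neighbours[OF i] by argo
qed

lemma restrict_perm_iso:
  assumes s: "\<sigma> \<in> graph_isos (binding_order n) B1 B2"
  shows "restrict_perm n \<sigma> \<in> graph_isos n A1 A2"
proof -
  have p: "\<sigma> permutes {..<binding_order n}" using s by (rule graph_isos_permutes)
  have basic: "\<sigma> i < n" if "i < n" for i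
    using iso_preserves_basic[OF s, of i] that G1.n_le by simp
  have "inj_on (restrict_perm n \<sigma>) {..<n}"
    using permutes_inj[OF p] by (auto simp: inj_on_def restrict_perm_def dest: injD)
  moreover have "restrict_perm n \<sigma> ` {..<n} \<subseteq> {..<n}"
    using basic by (auto simp: restrict_perm_def)
  \<comment> \<open>An injective self-map of a finite set is onto.\<close>
  ultimately have "bij_betw (restrict_perm n \<sigma>) {..<n} {..<n}"
    by (simp add: bij_betw_def endo_inj_surj)
  then have "restrict_perm n \<sigma> permutes {..<n}"
    by (rule bij_imp_permutes) (simp add: restrict_perm_def)
  moreover have "neighbour A1 (\<sigma> i) (\<sigma> j) \<longleftrightarrow> neighbour A2 i j" if "i < n" "j < n" for i j
  proof -
    have "i < binding_order n" "j < binding_order n" using that G1.n_le by simp_all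
    then have "neighbour B1 (\<sigma> i) (\<sigma> j) \<longleftrightarrow> neighbour B2 i j"
      using s unfolding isos_B_iff by blast
    then show ?thesis
      by (simp only: G1.neighbour_basic[OF basic basic, OF that] G2.neighbour_basic[OF that])
  qed
  ultimately show ?thesis by (simp add: isos_A_iff restrict_perm_def)
qed

text \<open>The values on basic vertices fix the image of the pair bound by \<open>i\<close>, and a
  binding vertex of \<open>B1\<close> is determined by its pair. From \<open>binding_order n\<close>
  on both maps are the identity.\<close>

lemma inj_on_restrict_perm:
  "inj_on (restrict_perm n) (graph_isos (binding_order n) B1 B2)"
proof (intro inj_onI ext)
  fix \<sigma> \<sigma>' i
  assume s: "\<sigma> \<in> graph_isos (binding_order n) B1 B2"
    and s': "\<sigma>' \<in> graph_isos (binding_order n) B1 B2"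
    and eq: "restrict_perm n \<sigma> = restrict_perm n \<sigma>'"
  have basic: "\<sigma> j = \<sigma>' j" if "j < n" for j
    using fun_cong[OF eq, of j] that by (simp add: restrict_perm_def)
  note p = graph_isos_permutes[OF s] and p' = graph_isos_permutes[OF s']
  consider "i < n" | "i \<in> {n..<binding_order n}" | "i \<ge> binding_order n" by force
  then show "\<sigma> i = \<sigma>' i"
  proof cases
    case 2
    then have i: "i < binding_order n" by simp
    have "neighbours B2 i \<subseteq> {..<n}"
      using G2.neighbours_binding_pair[OF 2] by (simp add: pairs_def)
    then have "\<sigma> ` neighbours B2 i = \<sigma>' ` neighbours B2 i"
      using basic by (intro image_cong) auto
    then have "neighbours B1 (\<sigma> i) = neighbours B1 (\<sigma>' i)"
      using neighbours_iso_B[OF s i] neighbours_iso_B[OF s' i] by simp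
    moreover have "\<sigma> i \<in> {n..<binding_order n}" "\<sigma>' i \<in> {n..<binding_order n}"
      using iso_preserves_basic[OF s i] iso_preserves_basic[OF s' i] 2
        permutes_in_image[OF p, of i] permutes_in_image[OF p', of i] by simp_all
    ultimately show ?thesis
      by (rule inj_onD[OF bij_betw_imp_inj_on[OF G1.bij_betw_neighbours]])
  qed (simp_all add: basic permutes_not_in[OF p] permutes_not_in[OF p'])
qed

lemma iso_extends:
  assumes t: "\<tau> \<in> graph_isos n A1 A2"
  obtains \<sigma> where "\<sigma> \<in> graph_isos (binding_order n) B1 B2" "restrict_perm n \<sigma> = \<tau>"
proof -
  let ?Q = "{n..<binding_order n}"
  have p: "\<tau> permutes {..<n}" using t by (rule graph_isos_permutes)
  \<comment> \<open>\<open>b q\<close> is the vertex of \<open>B1\<close> that binds the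
    \<open>\<tau>\<close>-image of the pair bound by \<open>q\<close> in \<open>B2\<close>.\<close>
  define b where "b = inv_into ?Q (neighbours B1) \<circ> ((`) \<tau> \<circ> neighbours B2)"
  \<comment> \<open>The default \<open>\<tau> i\<close> also covers \<open>i\<close> beyond the
    order of the binding graphs, where \<open>\<tau>\<close> is the identity.\<close>
  define \<sigma> where
    "\<sigma> i = (if i \<in> ?Q then b i else \<tau> i)" for i
  have bij_image: "bij_betw ((`) \<tau> \<circ> neighbours B2) ?Q (pairs n)"
    by (rule bij_betw_trans[OF G2.bij_betw_neighbours bij_betw_pairs_image[OF p]])
  then have bij_b: "bij_betw b ?Q ?Q"
    unfolding b_def
    by (rule bij_betw_trans[OF _ bij_betw_inv_into[OF G1.bij_betw_neighbours]])
  have nb_b: "neighbours B1 (b q) = \<tau> ` neighbours B2 q" if "q \<in> ?Q" for q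
  proof -
    have "\<tau> ` neighbours B2 q \<in> neighbours B1 ` ?Q"
      using bij_betwE[OF bij_image] that bij_betw_imp_surj_on[OF G1.bij_betw_neighbours]
      by simp
    then show ?thesis by (simp add: b_def f_inv_into_f)
  qed
  have b_Q: "b q \<in> ?Q" if "q \<in> ?Q" for q using bij_b that by (rule bspec[OF bij_betwE])
  have "bij_betw \<sigma> {..<n} {..<n}"
    using permutes_imp_bij[OF p] by (rule bij_betw_cong[THEN iffD1, rotated]) (simp add: \<sigma>_def)
  moreover have "bij_betw \<sigma> ?Q ?Q"
    using bij_b by (rule bij_betw_cong[THEN iffD1, rotated]) (simp add: \<sigma>_def)
  ultimately have "bij_betw \<sigma> ({..<n} \<union> ?Q) ({..<n} \<union> ?Q)"
    by (rule bij_betw_combine) auto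
  moreover have "{..<n} \<union> ?Q = {..<binding_order n}" using G1.n_le by auto
  ultimately have bij: "bij_betw \<sigma> {..<binding_order n} {..<binding_order n}" by simp
  have perm: "\<sigma> permutes {..<binding_order n}"
    using G1.n_le by (intro bij_imp_permutes[OF bij]) (simp add: \<sigma>_def permutes_not_in[OF p])
  have less: "\<tau> i < n" if "i < n" for i using permutes_in_image[OF p] that by auto
  \<comment> \<open>Injectivity of \<open>\<tau>\<close> gives that \<open>\<tau> i\<close> lies in
    the image of the pair of \<open>q\<close> only if \<open>i\<close> lies in that pair.\<close>
  have mixed: "neighbour B1 (b q) (\<tau> i) \<longleftrightarrow> neighbour B2 q i" if "q \<in> ?Q" for q i
    using nb_b[OF that] inj_image_mem_iff[OF permutes_inj[OF p]]
    by (simp add: in_neighbours_iff[symmetric])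
  have "neighbour B1 (\<sigma> i) (\<sigma> j) \<longleftrightarrow> neighbour B2 i j"
    if "i < binding_order n" "j < binding_order n" for i j
  proof -
    \<comment> \<open>Edges between basic vertices come from \<open>\<tau>\<close>, binding edges
      from \<open>mixed\<close> up to symmetry, and two binding vertices are never adjacent.\<close>
    consider "i < n" "j < n" | "i \<in> ?Q" "j < n" | "i < n" "j \<in> ?Q" | "i \<in> ?Q" "j \<in> ?Q"
      using \<open>i < _\<close> \<open>j < _\<close> by force
    then show ?thesis
    proof cases
      case 1
      then have "neighbour A1 (\<tau> i) (\<tau> j) \<longleftrightarrow> neighbour A2 i j" using t isos_A_iff by blast
      then show ?thesis
        using 1 less by (simp add: \<sigma>_def G1.neighbour_basic G2.neighbour_basic)
    next
      case 2
      then show ?thesis using mixed[of i j] by (simp add: \<sigma>_def)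
    next
      case 3
      then show ?thesis
        using mixed[of j i] neighbour_sym[OF G1.simple_B, of "b j" "\<tau> i"]
          neighbour_sym[OF G2.simple_B, of i j] by (simp add: \<sigma>_def)
    next
      case 4
      then show ?thesis
        using G1.not_neighbour_binding[OF b_Q b_Q] G2.not_neighbour_binding by (simp add: \<sigma>_def)
    qed
  qed
  with perm have "\<sigma> \<in> graph_isos (binding_order n) B1 B2" by (simp add: isos_B_iff)
  moreover have "restrict_perm n \<sigma> = \<tau>"
    using permutes_not_in[OF p] by (auto simp: restrict_perm_def \<sigma>_def)
  ultimately show ?thesis by (rule that)
qed

lemma bij_betw_restrict_perm:
  "bij_betw (restrict_perm n) (graph_isos (binding_order n) B1 B2) (graph_isos n A1 A2)"
proof (rule bij_betw_imageI[OF inj_on_restrict_perm], intro equalityI subsetI)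
  fix \<tau> assume "\<tau> \<in> graph_isos n A1 A2"
  then obtain \<sigma> where "\<sigma> \<in> graph_isos (binding_order n) B1 B2" "restrict_perm n \<sigma> = \<tau>"
    by (rule iso_extends)
  then show "\<tau> \<in> restrict_perm n ` graph_isos (binding_order n) B1 B2" by blast
qed (use restrict_perm_iso in blast)

text \<open>Sets in bijection are empty together.\<close>

lemma graph_isomorphic_iff:
  "graph_isomorphic n A1 A2 \<longleftrightarrow> graph_isomorphic (binding_order n) B1 B2"
  using bij_betw_restrict_perm by (auto simp: graph_isomorphic_def bij_betw_def)

end

section \<open>Automorphism groups and orbits\<close>

text \<open>Taking both graphs equal specializes the results on isomorphisms to
  automorphisms.\<close>

sublocale bound_graph \<subseteq> self: two_bound_graphs n l A B A B
  by unfold_locales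

context bound_graph
begin

lemma aut_group_iso: "aut_group n A \<cong> aut_group N B"
proof -
  \<comment> \<open>The inner factor \<open>\<sigma>'\<close> keeps basic vertices basic, so the
    outer one is applied to a basic vertex, where it agrees with its restriction.\<close>
  have "restrict_perm n (\<sigma> \<circ> \<sigma>') = restrict_perm n \<sigma> \<circ> restrict_perm n \<sigma>'"
    if "\<sigma>' \<in> graph_isos N B B" for \<sigma> \<sigma>'
    using self.iso_preserves_basic[OF that] n_le by (auto simp: restrict_perm_def)
  then have "restrict_perm n \<in> iso (aut_group N B) (aut_group n A)"
    using self.bij_betw_restrict_perm
    by (auto simp: iso_def hom_def aut_group_def bij_betw_def)
  then have "aut_group N B \<cong> aut_group n A" by (auto simp: is_iso_def)
  then show ?thesis by (rule group.iso_sym[OF group_aut_group])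
qed

text \<open>Restriction does not change the image of a basic vertex, and it maps onto the
  automorphisms of \<open>A\<close>.\<close>

lemma orbit_basic:
  assumes x: "x < n"
  shows "orbit (aut_group N B) (\<lambda>\<sigma>. \<sigma>) x = orbit (aut_group n A) (\<lambda>\<sigma>. \<sigma>) x"
proof -
  have "orbit (aut_group n A) (\<lambda>\<sigma>. \<sigma>) x = (\<lambda>\<tau>. \<tau> x) ` restrict_perm n ` graph_isos N B B"
    using self.bij_betw_restrict_perm by (auto simp: orbit_def aut_group_def bij_betw_def)
  then show ?thesis using x by (auto simp: orbit_def aut_group_def restrict_perm_def image_image)
qed

text \<open>Both \<open>u\<close> and \<open>v\<close> are images of one vertex under automorphisms,
  hence both of its kind.\<close>

lemma aut_orbit_basic_iff:
  assumes S: "S \<in> aut_orbits N B" and "u \<in> S" and "v \<in> S"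
  shows "u < n \<longleftrightarrow> v < n"
  using assms self.iso_preserves_basic by (auto simp: aut_orbits_def orbits_def orbit_def aut_group_def)

text \<open>An orbit contains its representative and consists of vertices of one kind, so it lies
  among the basic vertices iff its representative does; there the orbits of both groups
  agree.\<close>

lemma basic_aut_orbits:
  "{S \<in> aut_orbits N B. S \<subseteq> {..<n}} = aut_orbits n A"
proof (intro equalityI subsetI)
  fix S assume "S \<in> {S \<in> aut_orbits N B. S \<subseteq> {..<n}}"
  then obtain x where S: "S = orbit (aut_group N B) (\<lambda>\<sigma>. \<sigma>) x" "S \<subseteq> {..<n}"
    by (auto simp: aut_orbits_def orbits_def)
  then have "x < n" using mem_orbit_self by blast
  then show "S \<in> aut_orbits n A"
    using S orbit_basic by (auto simp: aut_orbits_def orbits_def)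
next
  fix S assume "S \<in> aut_orbits n A"
  then obtain x where x: "x < n" and S: "S = orbit (aut_group N B) (\<lambda>\<sigma>. \<sigma>) x"
    using orbit_basic by (auto simp: aut_orbits_def orbits_def)
  have orb: "S \<in> aut_orbits N B"
    using S x n_le by (auto simp: aut_orbits_def orbits_def)
  moreover have "S \<subseteq> {..<n}"
    using aut_orbit_basic_iff[OF orb] mem_orbit_self x S by blast
  ultimately show "S \<in> {S \<in> aut_orbits N B. S \<subseteq> {..<n}}" by simp
qed

end

theorem theorem7:
  fixes n :: nat and l :: label and A1 A2 B1 B2 :: "label mat"
  assumes "n > 2"
    and "simple_graph n A1" and "connected_graph A1"
    and "simple_graph n A2" and "connected_graph A2"
    and "edges_labelled l A1" and "edges_labelled l A2"
    and "binding_graph n A1 B1" and "edges_labelled l B1"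
    and "binding_graph n A2 B2" and "edges_labelled l B2"
  shows "(graph_isomorphic n A1 A2 \<longleftrightarrow> graph_isomorphic (binding_order n) B1 B2)
    \<and> aut_group n A1 \<cong> aut_group (binding_order n) B1
    \<and> (\<forall>u\<in>basic_vertices n. \<forall>p\<in>binding_vertices n.
         \<not> (\<exists>S\<in>aut_orbits (binding_order n) B1. u \<in> S \<and> p \<in> S))
    \<and> {S \<in> aut_orbits (binding_order n) B1. S \<subseteq> basic_vertices n} = aut_orbits n A1"
proof -
  interpret G: two_bound_graphs n l A1 B1 A2 B2
    using assms by unfold_locales
  have "\<not> (\<exists>S\<in>aut_orbits (binding_order n) B1. u \<in> S \<and> p \<in> S)"
    if "u \<in> basic_vertices n" "p \<in> binding_vertices n" for u p
    using G.G1.aut_orbit_basic_iff[of _ u p] that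
    by (auto simp: basic_vertices_def binding_vertices_def)
  then show ?thesis
    using G.graph_isomorphic_iff G.G1.aut_group_iso G.G1.basic_aut_orbits
    by (simp add: basic_vertices_def)
qed

end
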